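(* Let $\varphi = \forall \pi_1 \mathpunct{.} \forall \pi_2 \mathpunct{.} \psi$ be a HyperLTL formula, where $\psi$ is an LTL formula over the trace variables $\{\pi_1, \pi_2\}$. Then $\varphi$ is transitive if and only if \[ \varphi_\mathit{trans} = \exists \pi_1 \exists \pi_2 \exists \pi_3 \mathpunct{.} \big(\psi(\pi_1, \pi_2) \wedge \psi(\pi_2, \pi_3)\big) \nrightarrow \psi(\pi_1, \pi_3) \] is unsatisfiable.
   Context: Let $AP$ be a set of atomic propositions and $\Sigma = 2^{AP}$; traces are infinite words in $\Sigma^\omega$. A HyperLTL formula has the form $Q_1\pi_1\dots Q_n\pi_n\mathpunct{.}\psi$ with $Q_i\in\{\forall,\exists\}$, trace variables $\pi_i$, and $\psi$ an LTL formula whose atomic propositions are of the form $a_\pi$ ($a\in AP$), meaning $a$ holds at the current position of the trace assigned to $\pi$. For a set of traces $T$ and an assignment $\Pi$ of traces in $T$ to trace variables, $\Pi\models_T\psi$ is the usual LTL semantics evaluated synchronously on the assigned traces; quantifiers range over $T$. A HyperLTL formula is satisfiable if some nonempty set of traces satisfies it. $\psi(\pi_i,\pi_j)$ denotes $\psi$ with $\pi_1$ replaced by $\pi_i$ and $\pi_2$ by $\pi_j$; $A\nrightarrow B$ means $\neg(A\rightarrow B)$. The formula $\varphi$ is transitive if for every three-element set of traces $T=\{t_1,t_2,t_3\}\subseteq\Sigma^\omega$, writing $\Pi_{i,j}=\{\pi_1\mapsto t_i,\pi_2\mapsto t_j\}$, we have $(\Pi_{1,2}\models_T\psi)\wedge(\Pi_{2,3}\models_T\psi)\Rightarrow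 \Pi_{1,3}\models_T\psi$.
   Formalization: In the definition of transitive, the traces t1, t2, t3 are not required to be distinct, so T may have fewer than three elements; with three distinct traces the claim fails, e.g. for ψ expressing that π1 and π2 differ on a at some position. *)

theory Defs
  imports Main "HOL-Library.Omega_Words_Fun"
begin

type_synonym 'a trace = "'a set word"

text \<open>Trace variables are indices: \<open>i\<close> stands for $\pi_i$.\<close>

type_synonym tvar = nat

datatype (aps: 'a, tvars: 'v) ltl =
    Atom 'a 'v
  | Neg "('a, 'v) ltl"
  | Or "('a, 'v) ltl" "('a, 'v) ltl"
  | Next "('a, 'v) ltl"
  | Until "('a, 'v) ltl" "('a, 'v) ltl"
  for map: map_ltl

definition And :: "('a, 'v) ltl \<Rightarrow> ('a, 'v) ltl \<Rightarrow> ('a, 'v) ltl" where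
  "And \<phi> \<psi> = Neg (Or (Neg \<phi>) (Neg \<psi>))"

definition Imp :: "('a, 'v) ltl \<Rightarrow> ('a, 'v) ltl \<Rightarrow> ('a, 'v) ltl" where
  "Imp \<phi> \<psi> = Or (Neg \<phi>) \<psi>"

definition NImp :: "('a, 'v) ltl \<Rightarrow> ('a, 'v) ltl \<Rightarrow> ('a, 'v) ltl" where
  "NImp \<phi> \<psi> = Neg (Imp \<phi> \<psi>)"

datatype ('a, 'v) hyperltl =
    Matrix "('a, 'v) ltl"
  | Forall 'v "('a, 'v) hyperltl"
  | Exists 'v "('a, 'v) hyperltl"

type_synonym ('a, 'v) assignment = "'v \<Rightarrow> 'a trace option"

definition shift :: "nat \<Rightarrow> ('a, 'v) assignment \<Rightarrow> ('a, 'v) assignment" where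
  "shift k \<Pi> = (\<lambda>v. map_option (suffix k) (\<Pi> v))"

text \<open>Atoms over unassigned trace variables are false; this case does not arise
  when every trace variable of the formula is assigned.\<close>

primrec ltl_sat :: "('a, 'v) assignment \<Rightarrow> ('a, 'v) ltl \<Rightarrow> bool" where
  "ltl_sat \<Pi> (Atom a v) = (case \<Pi> v of None \<Rightarrow> False | Some t \<Rightarrow> a \<in> t 0)"
| "ltl_sat \<Pi> (Neg \<phi>) = (\<not> ltl_sat \<Pi> \<phi>)"
| "ltl_sat \<Pi> (Or \<phi> \<psi>) = (ltl_sat \<Pi> \<phi> \<or> ltl_sat \<Pi> \<psi>)"
| "ltl_sat \<Pi> (Next \<phi>) = ltl_sat (shift 1 \<Pi>) \<phi>"
| "ltl_sat \<Pi> (Until \<phi> \<psi>) =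
     (\<exists>i. ltl_sat (shift i \<Pi>) \<psi> \<and> (\<forall>j<i. ltl_sat (shift j \<Pi>) \<phi>))"

primrec hyperltl_sat ::
  "'a trace set \<Rightarrow> ('a, 'v) assignment \<Rightarrow> ('a, 'v) hyperltl \<Rightarrow> bool" where
  "hyperltl_sat T \<Pi> (Matrix \<psi>) = ltl_sat \<Pi> \<psi>"
| "hyperltl_sat T \<Pi> (Forall v \<phi>) = (\<forall>t\<in>T. hyperltl_sat T (\<Pi>(v \<mapsto> t)) \<phi>)"
| "hyperltl_sat T \<Pi> (Exists v \<phi>) = (\<exists>t\<in>T. hyperltl_sat T (\<Pi>(v \<mapsto> t)) \<phi>)"

definition satisfiable :: "('a, 'v) hyperltl \<Rightarrow> bool" where
  "satisfiable \<phi> \<longleftrightarrow> (\<exists>T. T \<noteq> {} \<and> hyperltl_sat T Map.empty \<phi>)"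

text \<open>\<open>inst \<psi> i j\<close> is $\psi(\pi_i, \pi_j)$: the variables $\pi_1$ and $\pi_2$
  are replaced simultaneously.\<close>

definition inst :: "('a, tvar) ltl \<Rightarrow> tvar \<Rightarrow> tvar \<Rightarrow> ('a, tvar) ltl" where
  "inst \<psi> i j = map_ltl id (id(1 := i, 2 := j)) \<psi>"

text \<open>The traces \<open>t\<^sub>1, t\<^sub>2, t\<^sub>3\<close> need not be pairwise distinct: existential trace
  quantifiers may pick the same trace twice, so with distinctness the formula
  expressing $\pi_1 \neq \pi_2$ would be transitive while its $\varphi_{trans}$
  is satisfiable.\<close>

definition transitive :: "('a, tvar) hyperltl \<Rightarrow> bool" where
  "transitive \<phi> \<longleftrightarrow> (\<exists>\<psi>. \<phi> = Forall 1 (Forall 2 (Matrix \<psi>)) \<and>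
     (\<forall>T t\<^sub>1 t\<^sub>2 t\<^sub>3. T = {t\<^sub>1, t\<^sub>2, t\<^sub>3} \<longrightarrow>
        hyperltl_sat T [1 \<mapsto> t\<^sub>1, 2 \<mapsto> t\<^sub>2] (Matrix \<psi>) \<and>
        hyperltl_sat T [1 \<mapsto> t\<^sub>2, 2 \<mapsto> t\<^sub>3] (Matrix \<psi>) \<longrightarrow>
        hyperltl_sat T [1 \<mapsto> t\<^sub>1, 2 \<mapsto> t\<^sub>3] (Matrix \<psi>)))"

definition phi_trans :: "('a, tvar) ltl \<Rightarrow> ('a, tvar) hyperltl" where
  "phi_trans \<psi> = Exists 1 (Exists 2 (Exists 3
     (Matrix (NImp (And (inst \<psi> 1 2) (inst \<psi> 2 3)) (inst \<psi> 1 3)))))"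

end

theory Submission imports Defs begin

text \<open>The existential prefix of \<open>phi_trans\<close> asks for exactly a counterexample
  triple to transitivity. Two facts make this precise. By \<open>ltl_sat_inst\<close>, evaluating
  the renamed matrix on three traces amounts to evaluating \<psi> on the chosen pair. Since
  satisfaction of the matrix ignores the trace set, a triple found anywhere is a triple in the set
  of all traces, so \<open>satisfiable_phi_trans_iff\<close> can drop the model.\<close>

lemma shift_comp: "shift k (\<Pi> \<circ> f) = shift k \<Pi> \<circ> f"
  by (simp add: shift_def comp_def)

text \<open>Substitution lemma: renaming variables is precomposition on assignments. Temporal
  operators change only the traces, not the variable names, so shifting commutes with it; the
  induction must range over all assignments because \<open>Next\<close> and \<open>Until\<close>
  shift them.\<close>

lemma ltl_sat_map_ltl: "ltl_sat \<Pi> (map_ltl id f \<psi>) \<longleftrightarrow> ltl_sat (\<Pi> \<circ> f) \<psi>"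
  by (induction \<psi> arbitrary: \<Pi>) (simp_all add: shift_comp)

lemma ltl_sat_cong:
  assumes "\<And>v. v \<in> tvars \<psi> \<Longrightarrow> \<Pi> v = \<Pi>' v"
  shows "ltl_sat \<Pi> \<psi> \<longleftrightarrow> ltl_sat \<Pi>' \<psi>"
  using assms
proof (induction \<psi> arbitrary: \<Pi> \<Pi>')
  case (Next \<psi>)
  have "ltl_sat (shift 1 \<Pi>) \<psi> = ltl_sat (shift 1 \<Pi>') \<psi>"
    by (rule Next.IH) (simp add: shift_def Next.prems)
  then show ?case by simp
next
  case (Until \<psi>1 \<psi>2)
  have "ltl_sat (shift k \<Pi>) \<psi>1 = ltl_sat (shift k \<Pi>') \<psi>1" for k
    by (rule Until.IH(1)) (simp add: shift_def Until.prems)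
  moreover have "ltl_sat (shift k \<Pi>) \<psi>2 = ltl_sat (shift k \<Pi>') \<psi>2" for k
    by (rule Until.IH(2)) (simp add: shift_def Until.prems)
  ultimately show ?case by simp
next
  case (Or \<psi>1 \<psi>2)
  have "ltl_sat \<Pi> \<psi>1 = ltl_sat \<Pi>' \<psi>1"
    by (rule Or.IH(1)) (simp add: Or.prems)
  moreover have "ltl_sat \<Pi> \<psi>2 = ltl_sat \<Pi>' \<psi>2"
    by (rule Or.IH(2)) (simp add: Or.prems)
  ultimately show ?case by simp
next
  case (Neg \<psi>)
  have "ltl_sat \<Pi> \<psi> = ltl_sat \<Pi>' \<psi>"
    by (rule Neg.IH) (simp add: Neg.prems)
  then show ?case by simp
qed simp

lemma ltl_sat_inst:
  assumes "tvars \<psi> \<subseteq> {1, 2}" "\<Pi> i = Some s" "\<Pi> j = Some t"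
  shows "ltl_sat \<Pi> (inst \<psi> i j) \<longleftrightarrow> ltl_sat [1 \<mapsto> s, 2 \<mapsto> t] \<psi>"
  unfolding inst_def ltl_sat_map_ltl
  \<comment> \<open>Off 1 and 2 the renamed assignment still agrees with \<Pi>, which may be defined
    there, for instance at 3; hence the comparison only on \<open>tvars\<close>.\<close>
  by (rule ltl_sat_cong) (use assms in auto)

lemma satisfiable_phi_trans_iff:
  assumes "tvars \<psi> \<subseteq> {1, 2}"
  shows "satisfiable (phi_trans \<psi>) \<longleftrightarrow>
    (\<exists>t\<^sub>1 t\<^sub>2 t\<^sub>3. ltl_sat [1 \<mapsto> t\<^sub>1, 2 \<mapsto> t\<^sub>2] \<psi> \<and> ltl_sat [1 \<mapsto> t\<^sub>2, 2 \<mapsto> t\<^sub>3] \<psi> \<and>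
      \<not> ltl_sat [1 \<mapsto> t\<^sub>1, 2 \<mapsto> t\<^sub>3] \<psi>)" (is "_ \<longleftrightarrow> (\<exists>t\<^sub>1 t\<^sub>2 t\<^sub>3. ?C t\<^sub>1 t\<^sub>2 t\<^sub>3)")
proof -
  have "hyperltl_sat T Map.empty (phi_trans \<psi>) \<longleftrightarrow>
      (\<exists>t\<^sub>1\<in>T. \<exists>t\<^sub>2\<in>T. \<exists>t\<^sub>3\<in>T. ?C t\<^sub>1 t\<^sub>2 t\<^sub>3)" for T
  proof -
    have "ltl_sat [1 \<mapsto> t\<^sub>1, 2 \<mapsto> t\<^sub>2, 3 \<mapsto> t\<^sub>3] (inst \<psi> 1 2) = ltl_sat [1 \<mapsto> t\<^sub>1, 2 \<mapsto> t\<^sub>2] \<psi>"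
      "ltl_sat [1 \<mapsto> t\<^sub>1, 2 \<mapsto> t\<^sub>2, 3 \<mapsto> t\<^sub>3] (inst \<psi> 2 3) = ltl_sat [1 \<mapsto> t\<^sub>2, 2 \<mapsto> t\<^sub>3] \<psi>"
      "ltl_sat [1 \<mapsto> t\<^sub>1, 2 \<mapsto> t\<^sub>2, 3 \<mapsto> t\<^sub>3] (inst \<psi> 1 3) = ltl_sat [1 \<mapsto> t\<^sub>1, 2 \<mapsto> t\<^sub>3] \<psi>"
      for t\<^sub>1 t\<^sub>2 t\<^sub>3
      by (rule ltl_sat_inst[OF assms]; simp)+
    then show ?thesis
      by (simp only: phi_trans_def hyperltl_sat.simps NImp_def Imp_def And_def ltl_sat.simps)
        blast
  qed
  then show ?thesis
    \<comment> \<open>The witness for the model is \<open>UNIV\<close>: it is nonempty and contains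
      every triple.\<close>
    unfolding satisfiable_def by (metis UNIV_I empty_iff)
qed

theorem mainTheorem2:
  fixes \<psi> :: "('a, tvar) ltl" and \<phi> :: "('a, tvar) hyperltl"
  assumes "tvars \<psi> \<subseteq> {1, 2}"
    and "\<phi> = Forall 1 (Forall 2 (Matrix \<psi>))"
  shows "transitive \<phi> \<longleftrightarrow> \<not> satisfiable (phi_trans \<psi>)"
  unfolding satisfiable_phi_trans_iff[OF assms(1)] transitive_def assms(2)
  \<comment> \<open>Injectivity of the constructors identifies the matrix hidden in
    \<open>transitive\<close> with the given \<psi>; what remains is the negation of an
    existential.\<close>
  by (simp only: hyperltl_sat.simps hyperltl.inject) blast

end
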